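(* Let $\rho,t>0$ and let $M_1\in\mathbb S_+^p$, $M_2\in\mathbb S_+^q$ with $\lambda_{\min}(M_2)>\rho\lambda_{\max}(B^TB)$. The primal algorithmic map $\mathrm{Prim}_t$ that sends $(z,\lambda)$, $z=(u,v)$, to $z^+=(u^+,v^+)$ defined by $$u^+=\operatorname{argmin}_{\xi_1}\left\{f(\xi_1)+\langle\lambda,A\xi_1+Bv-b\rangle+\frac{\rho_t}{2}\|A\xi_1+Bv-b\|^2+\frac{1}{2t}\|\xi_1-u\|_{M_1}^2\right\},$$ $$v^+=\operatorname{argmin}_{\xi_2}\left\{g(\xi_2)+\langle\lambda,Au^++B\xi_2-b\rangle+\rho_t\langle Au^++Bv-b,B\xi_2\rangle+\frac{\tau_t}{2}\|\xi_2-v\|_{M_2}^2\right\}$$ is nice (block version, see the context) with $\delta=1-\rho\lambda_{\max}(B^TB)/\lambda_{\min}(M_2)$, $P_1=Q_1=M_1$, $P_2=M_2$ and $Q_2=0$.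
   Context: **Problem.** Let $f:\mathbb R^p\to(-\infty,+\infty]$ and $g:\mathbb R^q\to(-\infty,+\infty]$ be proper, lower semicontinuous and convex, with $g$ moreover $\sigma$-strongly convex, $\sigma\ge0$ ($\sigma=0$ means merely convex); let $A:\mathbb R^p\to\mathbb R^m$, $B:\mathbb R^q\to\mathbb R^m$ be linear and $b\in\mathbb R^m$. For $z=(u,v)\in\mathbb R^p\times\mathbb R^q=\mathbb R^n$ put $\Psi(z)=f(u)+g(v)$, $\mathcal A z=Au+Bv$, $\mathcal F=\{z:\mathcal A z=b\}$; the problem is $\min\{\Psi(z):\mathcal A z=b\}$. The augmented Lagrangian is $\mathcal L_\rho(z,y)=\Psi(z)+\langle y,\mathcal A z-b\rangle+\frac\rho2\|\mathcal A z-b\|^2$. Standing assumption: the Lagrangian $\mathcal L_0$ has a saddle point. **Notation.** $\mathbb S_+^d$ is the set of $d\times d$ symmetric positive semidefinite matrices; for $P\in\mathbb S_+^d$, $\|u\|_P=\sqrt{\langle u,Pu\rangle}$ and $\Delta_P(u,v,w)=\frac12(\|u-v\|_P^2-\|u-w\|_P^2)$. $\lambda_{\min},\lambda_{\max}$ are the smallest and largest eigenvalues. **Nice primal algorithmic map (block version).** Given $\rho,t>0$, let $\tau_t=1,\rho_t=\rho$ if $\sigma=0$, and $\tau_t=t,\rho_t=\rho t$ if $\sigma>0$. A (possibly set-valued) map $\mathrm{Prim}_t$ on $\mathbb R^n\times\mathbb R^m$ with values in $\mathbb R^n$ is nice with $\delta\in(0,1]$, $P_1,Q_1\in\mathbb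 S_+^p$, $P_2,Q_2\in\mathbb S_+^q$ if for all $(z,\lambda)$ with $z=(u,v)$, all $z^+=(u^+,v^+)\in\mathrm{Prim}_t(z,\lambda)$ and all $\xi=(\xi_1,\xi_2)\in\mathcal F$, $$\mathcal L_{\rho_t}(z^+,\lambda)-\mathcal L_{\rho_t}(\xi,\lambda)\le\frac1t\Delta_{P_1}(\xi_1,u,u^+)-\frac1{2t}\|u^+-u\|_{Q_1}^2+\tau_t\Delta_{P_2}(\xi_2,v,v^+)-\frac{\tau_t}2\|v^+-v\|_{Q_2}^2-\frac\sigma2\|\xi_2-v^+\|^2-\frac{\delta\rho_t}2\|\mathcal A z^+-b\|^2.$$ Here $u^+=\operatorname{argmin}$ is understood as: $u^+$ is any minimizer. *)

theory Defs
  imports "HOL-Analysis.Analysis"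
begin

subsection \<open>Extended-real-valued convex functions\<close>

definition proper :: "('a \<Rightarrow> ereal) \<Rightarrow> bool" where
  "proper f \<longleftrightarrow> (\<forall>x. f x \<noteq> -\<infinity>) \<and> (\<exists>x. f x \<noteq> \<infinity>)"

definition lsc :: "('a::topological_space \<Rightarrow> ereal) \<Rightarrow> bool" where
  "lsc f \<longleftrightarrow> (\<forall>x. f x \<le> Liminf (at x) f)"

text \<open>The library's \<open>convex_on\<close> is restricted to real-valued functions. In both definitions
  below the functions are meant not to take the value \<open>-\<infinity>\<close>, so the sums on the right are never
  of the form \<open>\<infinity> - \<infinity>\<close>.\<close>

definition ereal_convex :: "('a::real_vector \<Rightarrow> ereal) \<Rightarrow> bool" where
  "ereal_convex f \<longleftrightarrow>
    (\<forall>x y. \<forall>\<theta>\<in>{0..1}. f ((1 - \<theta>) *\<^sub>R x + \<theta> *\<^sub>R y) \<le> ereal (1 - \<theta>) * f x + ereal \<theta> * f y)"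

definition ereal_strongly_convex :: "real \<Rightarrow> ('a::real_normed_vector \<Rightarrow> ereal) \<Rightarrow> bool" where
  "ereal_strongly_convex \<sigma> f \<longleftrightarrow>
    (\<forall>x y. \<forall>\<theta>\<in>{0..1}.
      f ((1 - \<theta>) *\<^sub>R x + \<theta> *\<^sub>R y) + ereal (\<sigma> / 2 * \<theta> * (1 - \<theta>) * (norm (x - y))\<^sup>2)
        \<le> ereal (1 - \<theta>) * f x + ereal \<theta> * f y)"

lemma ereal_strongly_convex_0: "ereal_strongly_convex 0 f \<longleftrightarrow> ereal_convex f"
  by (simp add: ereal_strongly_convex_def ereal_convex_def zero_ereal_def[symmetric])


subsection \<open>Matrices\<close>

definition psd :: "real^'d^'d \<Rightarrow> bool" where
  "psd P \<longleftrightarrow> transpose P = P \<and> (\<forall>x. 0 \<le> x \<bullet> (P *v x))"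

definition eigenvalues :: "real^'d^'d \<Rightarrow> real set" where
  "eigenvalues P = {c. \<exists>x. x \<noteq> 0 \<and> P *v x = c *\<^sub>R x}"

text \<open>Only used for symmetric matrices, whose set of real eigenvalues is finite and nonempty.\<close>

definition lambda_min :: "real^'d^'d \<Rightarrow> real" where
  "lambda_min P = Min (eigenvalues P)"

definition lambda_max :: "real^'d^'d \<Rightarrow> real" where
  "lambda_max P = Max (eigenvalues P)"

definition mnorm :: "real^'d^'d \<Rightarrow> real^'d \<Rightarrow> real" where
  "mnorm P u = sqrt (u \<bullet> (P *v u))"

definition Delta :: "real^'d^'d \<Rightarrow> real^'d \<Rightarrow> real^'d \<Rightarrow> real^'d \<Rightarrow> real" where
  "Delta P u v w = 1/2 * ((mnorm P (u - v))\<^sup>2 - (mnorm P (u - w))\<^sup>2)"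


subsection \<open>The two-block problem\<close>

definition Psi :: "(real^'p \<Rightarrow> ereal) \<Rightarrow> (real^'q \<Rightarrow> ereal) \<Rightarrow> (real^'p) \<times> (real^'q) \<Rightarrow> ereal" where
  "Psi f g z = f (fst z) + g (snd z)"

definition Aop :: "real^'p^'m \<Rightarrow> real^'q^'m \<Rightarrow> (real^'p) \<times> (real^'q) \<Rightarrow> real^'m" where
  "Aop A B z = A *v fst z + B *v snd z"

definition feasible :: "real^'p^'m \<Rightarrow> real^'q^'m \<Rightarrow> real^'m \<Rightarrow> ((real^'p) \<times> (real^'q)) set" where
  "feasible A B b = {z. Aop A B z = b}"

definition aug_lagrangian ::
  "(real^'p \<Rightarrow> ereal) \<Rightarrow> (real^'q \<Rightarrow> ereal) \<Rightarrow> real^'p^'m \<Rightarrow> real^'q^'m \<Rightarrow> real^'m \<Rightarrow>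
    real \<Rightarrow> (real^'p) \<times> (real^'q) \<Rightarrow> real^'m \<Rightarrow> ereal" where
  "aug_lagrangian f g A B b \<rho> z y =
    Psi f g z + ereal (y \<bullet> (Aop A B z - b) + \<rho> / 2 * (norm (Aop A B z - b))\<^sup>2)"

definition has_saddle_point ::
  "(real^'p \<Rightarrow> ereal) \<Rightarrow> (real^'q \<Rightarrow> ereal) \<Rightarrow> real^'p^'m \<Rightarrow> real^'q^'m \<Rightarrow> real^'m \<Rightarrow> bool" where
  "has_saddle_point f g A B b \<longleftrightarrow>
    (\<exists>z0 y0. \<forall>z y.
      aug_lagrangian f g A B b 0 z0 y \<le> aug_lagrangian f g A B b 0 z0 y0 \<and>
      aug_lagrangian f g A B b 0 z0 y0 \<le> aug_lagrangian f g A B b 0 z y0)"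

definition tau :: "real \<Rightarrow> real \<Rightarrow> real" where
  "tau \<sigma> t = (if \<sigma> = 0 then 1 else t)"

definition rho :: "real \<Rightarrow> real \<Rightarrow> real \<Rightarrow> real" where
  "rho \<sigma> \<rho> t = (if \<sigma> = 0 then \<rho> else \<rho> * t)"


subsection \<open>Nice primal algorithmic maps\<close>

text \<open>Set-valued maps are functions into \<open>set\<close>. The difference of Lagrangians is the one of
  \<open>ereal\<close>, where \<open>\<infinity> - \<infinity> = \<infinity>\<close>; the inequality therefore also forces every output of the map to
  have a finite Lagrangian value (as soon as the feasible set is nonempty), and it holds trivially
  at those \<open>\<xi>\<close> where \<open>Psi\<close> is infinite.\<close>

definition nice_primal_map ::
  "(real^'p \<Rightarrow> ereal) \<Rightarrow> (real^'q \<Rightarrow> ereal) \<Rightarrow> real^'p^'m \<Rightarrow> real^'q^'m \<Rightarrow> real^'m \<Rightarrow>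
    real \<Rightarrow> real \<Rightarrow> real \<Rightarrow>
    real \<Rightarrow> real^'p^'p \<Rightarrow> real^'p^'p \<Rightarrow> real^'q^'q \<Rightarrow> real^'q^'q \<Rightarrow>
    (((real^'p) \<times> (real^'q)) \<times> (real^'m) \<Rightarrow> ((real^'p) \<times> (real^'q)) set) \<Rightarrow> bool" where
  "nice_primal_map f g A B b \<sigma> \<rho> t \<delta> P1 Q1 P2 Q2 Prim \<longleftrightarrow>
    0 < \<delta> \<and> \<delta> \<le> 1 \<and> psd P1 \<and> psd Q1 \<and> psd P2 \<and> psd Q2 \<and>
    (\<forall>u v l u' v' \<xi>1 \<xi>2.
      (u', v') \<in> Prim ((u, v), l) \<longrightarrow> (\<xi>1, \<xi>2) \<in> feasible A B b \<longrightarrow>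
      aug_lagrangian f g A B b (rho \<sigma> \<rho> t) (u', v') l
        - aug_lagrangian f g A B b (rho \<sigma> \<rho> t) (\<xi>1, \<xi>2) l
      \<le> ereal (1 / t * Delta P1 \<xi>1 u u' - 1 / (2 * t) * (mnorm Q1 (u' - u))\<^sup>2
               + tau \<sigma> t * Delta P2 \<xi>2 v v' - tau \<sigma> t / 2 * (mnorm Q2 (v' - v))\<^sup>2
               - \<sigma> / 2 * (norm (\<xi>2 - v'))\<^sup>2
               - \<delta> * rho \<sigma> \<rho> t / 2 * (norm (Aop A B (u', v') - b))\<^sup>2))"

text \<open>One alternating step; the second block is a proximal step on the linearised penalty, using
  the new first block. All pairs of minimizers are admitted.\<close>

definition prim_map ::
  "(real^'p \<Rightarrow> ereal) \<Rightarrow> (real^'q \<Rightarrow> ereal) \<Rightarrow> real^'p^'m \<Rightarrow> real^'q^'m \<Rightarrow> real^'m \<Rightarrow>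
    real \<Rightarrow> real \<Rightarrow> real \<Rightarrow> real^'p^'p \<Rightarrow> real^'q^'q \<Rightarrow>
    ((real^'p) \<times> (real^'q)) \<times> (real^'m) \<Rightarrow> ((real^'p) \<times> (real^'q)) set" where
  "prim_map f g A B b \<sigma> \<rho> t M1 M2 = (\<lambda>((u, v), l). {(u', v').
    is_arg_min (\<lambda>\<xi>1. f \<xi>1 + ereal (l \<bullet> (A *v \<xi>1 + B *v v - b)
                 + rho \<sigma> \<rho> t / 2 * (norm (A *v \<xi>1 + B *v v - b))\<^sup>2
                 + 1 / (2 * t) * (mnorm M1 (\<xi>1 - u))\<^sup>2)) (\<lambda>_. True) u' \<and>
    is_arg_min (\<lambda>\<xi>2. g \<xi>2 + ereal (l \<bullet> (A *v u' + B *v \<xi>2 - b)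
                 + rho \<sigma> \<rho> t * ((A *v u' + B *v v - b) \<bullet> (B *v \<xi>2))
                 + tau \<sigma> t / 2 * (mnorm M2 (\<xi>2 - v))\<^sup>2)) (\<lambda>_. True) v'})"

end

theory Submission
  imports Defs
begin

text \<open>
  A minimizer of a convex function plus a quadratic does better than any competitor by the full
  second-order term of the quadratic, and by a further \<open>\<sigma>/2\<close> times the squared distance if the
  convex part is \<open>\<sigma>\<close>-strongly convex (\<open>minimizer_quadratic_growth\<close>). Applied to the two
  subproblems and compared at a feasible \<open>\<xi>\<close>, this yields two inequalities whose proximal terms are
  already the \<open>Delta\<close> terms of the claim. When they are added, the multiplier terms cancel against
  the one of the Lagrangian because \<open>\<xi>\<close> is feasible. With the residual \<open>s = A u' + B v' - b\<close>
  and the step \<open>e = v' - v\<close>, the penalty terms, in which the second block saw the old \<open>v\<close> only,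
  leave \<open>- r/2 |s|\<^sup>2 + r \<langle>s, B e\<rangle>\<close>, with \<open>r\<close> the penalty parameter.

  The cross term is paid for by two quantities: a part of the good term
  \<open>- r/2 |s|\<^sup>2\<close>, which is why only the fraction \<open>\<delta>\<close> of it survives, and all of the proximal gain
  \<open>\<tau>/2 |e|\<^sup>2\<close> in the norm of \<open>M2\<close>, which is why \<open>Q2 = 0\<close>. This works by Young's inequality,
  since \<open>r = \<rho> \<tau>\<close> in both regimes of the parameters and since, by the variational description of
  extreme eigenvalues (\<open>lambda_min_le_form\<close>, \<open>norm_sq_le_lambda_max\<close>), the proximal gain controls
  \<open>|B e|\<^sup>2\<close> up to the factor \<open>lambda_max (B\<^sup>T B) / lambda_min M2\<close>.
\<close>

section \<open>Extreme eigenvalues of symmetric matrices\<close>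

lemma symmetric_inner_swap:
  fixes P :: "real^'d^'d"
  assumes "transpose P = P"
  shows "x \<bullet> (P *v y) = y \<bullet> (P *v x)"
  by (metis assms dot_lmul_matrix inner_commute transpose_matrix_vector)

text \<open>Eigenvectors for distinct eigenvalues are orthogonal, and a Euclidean space contains no
  infinite orthogonal family of nonzero vectors.\<close>

lemma finite_eigenvalues_symmetric:
  fixes P :: "real^'d^'d"
  assumes sym: "transpose P = P"
  shows "finite (eigenvalues P)"
proof -
  have "\<forall>c\<in>eigenvalues P. \<exists>x. x \<noteq> 0 \<and> P *v x = c *\<^sub>R x"
    by (simp add: eigenvalues_def)
  then obtain w where "\<forall>c\<in>eigenvalues P. w c \<noteq> 0 \<and> P *v w c = c *\<^sub>R w c"
    by (rule bchoice[THEN exE])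
  then have w: "\<And>c. c \<in> eigenvalues P \<Longrightarrow> w c \<noteq> 0 \<and> P *v w c = c *\<^sub>R w c" by blast
  have orth: "w c \<bullet> w d = 0"
    if "c \<in> eigenvalues P" "d \<in> eigenvalues P" "c \<noteq> d" for c d
  proof -
    have "w c \<bullet> (P *v w d) = w d \<bullet> (P *v w c)" by (rule symmetric_inner_swap[OF sym])
    then have "d * (w c \<bullet> w d) = c * (w c \<bullet> w d)"
      using w that by (simp add: inner_commute)
    then show ?thesis using that by simp
  qed
  have inj: "inj_on w (eigenvalues P)"
    by (metis inj_onI inner_eq_zero_iff orth w)
  have "pairwise orthogonal (w ` eigenvalues P)"
    unfolding pairwise_def orthogonal_def using orth by auto
  then have "finite (w ` eigenvalues P)"
    by (rule pairwise_orthogonal_imp_finite)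
  then show ?thesis using inj finite_imageD by blast
qed

text \<open>The form is nonnegative near \<open>x\<close> in the direction \<open>P x\<close>, where its derivative at \<open>x\<close> is
  \<open>2 |P x|\<^sup>2\<close>; a small step backwards would make it negative unless \<open>P x = 0\<close>.\<close>

lemma psd_form_zero_imp_kernel:
  fixes P :: "real^'d^'d"
  assumes "psd P" and zero: "x \<bullet> (P *v x) = 0"
  shows "P *v x = 0"
proof (rule ccontr)
  assume nz: "P *v x \<noteq> 0"
  define y where "y = P *v x"
  define k where "k = y \<bullet> (P *v y)"
  define n where "n = y \<bullet> y"
  have n: "n > 0" using nz unfolding n_def y_def by simp
  have k: "k \<ge> 0" using assms(1) by (simp add: k_def psd_def)
  have xy: "x \<bullet> (P *v y) = n"
    using symmetric_inner_swap[of P x y] assms(1) by (simp add: n_def y_def psd_def)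
  \<comment> \<open>minimizes the parabola \<open>s \<mapsto> s\<^sup>2 k - 2 s n\<close>, up to the added \<open>1\<close> that keeps \<open>k = 0\<close> harmless\<close>
  define s where "s = n / (k + 1)"
  have "0 \<le> (x - s *\<^sub>R y) \<bullet> (P *v (x - s *\<^sub>R y))"
    using assms(1) by (simp add: psd_def)
  also have "\<dots> = s * (s * k - 2 * n)"
    using zero xy
    by (simp add: matrix_vector_mult_diff_distrib matrix_vector_mult_scaleR inner_diff_left
        inner_diff_right y_def[symmetric] n_def[symmetric] k_def[symmetric] algebra_simps)
  finally have ge: "0 \<le> s * (s * k - 2 * n)" .
  have "s > 0" using n k by (simp add: s_def)
  with ge have "2 * n \<le> s * k" by (simp add: zero_le_mult_iff)
  moreover have "s * k \<le> n"
    using n k by (simp add: s_def field_simps)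
  ultimately show False using n by simp
qed

text \<open>The minimum of the form on the unit sphere is an eigenvalue: subtracting it from \<open>P\<close> leaves a
  positive semidefinite matrix whose form vanishes at the minimizer.\<close>

lemma least_rayleigh_quotient_eigenvalue:
  fixes P :: "real^'d^'d"
  assumes sym: "transpose P = P"
  obtains c where "c \<in> eigenvalues P" "\<And>x. c * (norm x)\<^sup>2 \<le> x \<bullet> (P *v x)"
proof -
  have "continuous_on (sphere 0 1) (\<lambda>x. x \<bullet> (P *v x))"
    by (intro continuous_intros linear_continuous_on) (simp add: bounded_linear_def)
  moreover have "sphere (0 :: real^'d) 1 \<noteq> {}" by simp
  ultimately obtain x0 where x0: "norm x0 = 1"
    and min: "\<And>x. norm x = 1 \<Longrightarrow> x0 \<bullet> (P *v x0) \<le> x \<bullet> (P *v x)"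
    using continuous_attains_inf[of "sphere 0 1" "\<lambda>x. x \<bullet> (P *v x)"] by auto
  define c where "c = x0 \<bullet> (P *v x0)"
  have le: "c * (norm x)\<^sup>2 \<le> x \<bullet> (P *v x)" for x
  proof (cases "x = 0")
    case False
    have "c \<le> (x /\<^sub>R norm x) \<bullet> (P *v (x /\<^sub>R norm x))"
      unfolding c_def using False by (intro min) simp
    also have "\<dots> = x \<bullet> (P *v x) / (norm x)\<^sup>2"
      by (simp add: matrix_vector_mult_scaleR power2_eq_square field_simps)
    finally show ?thesis using False by (simp add: field_simps)
  qed simp
  define Q where "Q = P - c *\<^sub>R mat 1"
  have Qv: "Q *v x = P *v x - c *\<^sub>R x" for x
    by (simp add: Q_def matrix_vector_mult_diff_rdistrib scaleR_matrix_vector_assoc[symmetric])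
  have symQ: "transpose Q = Q"
  proof -
    have "P $ j $ i = P $ i $ j" for i j
      using sym by (metis transpose_def vec_lambda_beta)
    then show ?thesis
      by (simp add: Q_def transpose_def vec_eq_iff mat_def)
  qed
  have psdQ: "psd Q"
    unfolding psd_def using symQ le by (simp add: Qv inner_diff_right power2_norm_eq_inner)
  have "x0 \<bullet> (Q *v x0) = 0"
    using x0 by (simp add: Qv inner_diff_right c_def power2_norm_eq_inner[symmetric])
  then have "Q *v x0 = 0" by (rule psd_form_zero_imp_kernel[OF psdQ])
  moreover have "x0 \<noteq> 0" using x0 by auto
  ultimately have "c \<in> eigenvalues P"
    unfolding eigenvalues_def by (auto simp: Qv)
  then show ?thesis using le that by blast
qed

lemma lambda_min_le_form:
  fixes P :: "real^'d^'d"
  assumes "transpose P = P"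
  shows "lambda_min P * (norm x)\<^sup>2 \<le> x \<bullet> (P *v x)"
proof -
  obtain c where c: "c \<in> eigenvalues P" "\<And>x. c * (norm x)\<^sup>2 \<le> x \<bullet> (P *v x)"
    using least_rayleigh_quotient_eigenvalue[OF assms] by blast
  have "lambda_min P \<le> c"
    unfolding lambda_min_def by (rule Min_le[OF finite_eigenvalues_symmetric[OF assms] c(1)])
  then show ?thesis by (meson c(2) mult_right_mono order_trans zero_le_power2)
qed

text \<open>The smallest eigenvalue of \<open>- P\<close> is minus the largest one of \<open>P\<close>.\<close>

lemma form_le_lambda_max:
  fixes P :: "real^'d^'d"
  assumes sym: "transpose P = P"
  shows "x \<bullet> (P *v x) \<le> lambda_max P * (norm x)\<^sup>2"
proof -
  have neg: "(- P) *v y = - (P *v y)" for y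
    by (simp add: matrix_vector_mult_def vec_eq_iff sum_negf)
  have "transpose (- P) = - P"
    using sym by (simp add: transpose_def vec_eq_iff)
  then obtain c where c: "c \<in> eigenvalues (- P)"
      "\<And>x. c * (norm x)\<^sup>2 \<le> x \<bullet> ((- P) *v x)"
    using least_rayleigh_quotient_eigenvalue by blast
  have "- c \<in> eigenvalues P"
    using c(1) unfolding eigenvalues_def neg by (auto simp: minus_equation_iff eq_commute)
  then have "- c \<le> lambda_max P"
    unfolding lambda_max_def by (rule Max_ge[OF finite_eigenvalues_symmetric[OF sym]])
  then have "(- c) * (norm x)\<^sup>2 \<le> lambda_max P * (norm x)\<^sup>2"
    by (intro mult_right_mono) auto
  moreover have "x \<bullet> (P *v x) \<le> (- c) * (norm x)\<^sup>2"
    using c(2)[of x] by (simp add: neg)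
  ultimately show ?thesis by linarith
qed

lemma norm_sq_le_lambda_max:
  fixes B :: "real^'q^'m"
  shows "(norm (B *v x))\<^sup>2 \<le> lambda_max (transpose B ** B) * (norm x)\<^sup>2"
proof -
  have "(norm (B *v x))\<^sup>2 = x \<bullet> ((transpose B ** B) *v x)"
    by (metis dot_lmul_matrix inner_commute matrix_vector_mul_assoc power2_norm_eq_inner
        transpose_matrix_vector)
  also have "\<dots> \<le> lambda_max (transpose B ** B) * (norm x)\<^sup>2"
    by (rule form_le_lambda_max) (simp add: matrix_transpose_mul)
  finally show ?thesis .
qed

lemma lambda_max_gram_nonneg:
  fixes B :: "real^'q^'m"
  shows "0 \<le> lambda_max (transpose B ** B)"
proof -
  obtain x :: "real^'q" where "norm x = 1" using vector_choose_size[of 1] by auto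
  then show ?thesis
    using norm_sq_le_lambda_max[of B x] by (metis mult.right_neutral order_trans power_one zero_le_power2)
qed

section \<open>Minimizers of a convex function plus a quadratic\<close>

text \<open>Quadratic functions with second-order part \<open>N\<close>, described by their exact convexity defect.
  This is the form in which they combine with the inequality that defines strong convexity, and it
  makes no reference to derivatives.\<close>

definition quadratic_with :: "('a::real_vector \<Rightarrow> real) \<Rightarrow> ('a \<Rightarrow> real) \<Rightarrow> bool" where
  "quadratic_with N q \<longleftrightarrow> (\<forall>x y \<theta>. q ((1 - \<theta>) *\<^sub>R x + \<theta> *\<^sub>R y)
     = (1 - \<theta>) * q x + \<theta> * q y - \<theta> * (1 - \<theta>) * N (y - x))"

lemma quadratic_with_add:
  assumes "quadratic_with N q" "quadratic_with N' q'"
  shows "quadratic_with (\<lambda>d. N d + N' d) (\<lambda>x. q x + q' x)"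
  unfolding quadratic_with_def
  by (simp only: assms[unfolded quadratic_with_def, rule_format]) (simp add: algebra_simps)

lemma quadratic_with_cmult:
  assumes "quadratic_with N q"
  shows "quadratic_with (\<lambda>d. c * N d) (\<lambda>x. c * q x)"
  unfolding quadratic_with_def
  by (simp only: assms[unfolded quadratic_with_def, rule_format]) (simp add: algebra_simps)

lemma affine_combination:
  fixes A :: "real^'p^'m"
  shows "A *v ((1 - \<theta>) *\<^sub>R x + \<theta> *\<^sub>R y) + c = (1 - \<theta>) *\<^sub>R (A *v x + c) + \<theta> *\<^sub>R (A *v y + c)"
  by (simp add: matrix_vector_right_distrib matrix_vector_mult_scaleR algebra_simps)

lemma quadratic_with_affine:
  fixes A :: "real^'p^'m"
  shows "quadratic_with (\<lambda>_. 0) (\<lambda>x. l \<bullet> (A *v x + c))"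
  unfolding quadratic_with_def affine_combination by (simp only: inner_add_right inner_scaleR_right) simp

lemma quadratic_with_norm_sq:
  fixes A :: "real^'p^'m"
  shows "quadratic_with (\<lambda>d. (norm (A *v d))\<^sup>2) (\<lambda>x. (norm (A *v x + c))\<^sup>2)"
proof -
  have form: "(norm ((1 - \<theta>) *\<^sub>R a + \<theta> *\<^sub>R d))\<^sup>2
      = (1 - \<theta>) * (norm a)\<^sup>2 + \<theta> * (norm d)\<^sup>2 - \<theta> * (1 - \<theta>) * (norm (d - a))\<^sup>2"
    for a d :: "real^'m" and \<theta>
  proof -
    have "d \<bullet> a = a \<bullet> d" by (rule inner_commute)
    then show ?thesis
      unfolding power2_norm_eq_inner
      by (simp add: inner_add_left inner_add_right inner_diff_left inner_diff_right algebra_simps)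
  qed
  have "A *v (y - x) = (A *v y + c) - (A *v x + c)" for x y
    by (simp add: matrix_vector_mult_diff_distrib)
  then show ?thesis
    unfolding quadratic_with_def affine_combination by (simp only: form) simp
qed

lemma mnorm_sq: "psd P \<Longrightarrow> (mnorm P u)\<^sup>2 = u \<bullet> (P *v u)"
  by (simp add: mnorm_def psd_def)

lemma quadratic_with_mnorm_sq:
  assumes "psd P"
  shows "quadratic_with (\<lambda>d. (mnorm P d)\<^sup>2) (\<lambda>x. (mnorm P (x - u))\<^sup>2)"
proof -
  have form: "(mnorm P ((1 - \<theta>) *\<^sub>R a + \<theta> *\<^sub>R d))\<^sup>2
      = (1 - \<theta>) * (mnorm P a)\<^sup>2 + \<theta> * (mnorm P d)\<^sup>2 - \<theta> * (1 - \<theta>) * (mnorm P (d - a))\<^sup>2"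
    for a d \<theta>
    unfolding mnorm_sq[OF assms]
    by (simp add: matrix_vector_right_distrib matrix_vector_mult_diff_distrib
        matrix_vector_mult_scaleR inner_add_left inner_add_right inner_diff_left inner_diff_right
        algebra_simps)
  have "((1 - \<theta>) *\<^sub>R x + \<theta> *\<^sub>R y) - u = (1 - \<theta>) *\<^sub>R (x - u) + \<theta> *\<^sub>R (y - u)" for x y \<theta>
    by (simp add: algebra_simps)
  then show ?thesis
    using form[of _ "_ - u" "_ - u"] by (simp add: quadratic_with_def)
qed

lemma finite_at_minimizer:
  fixes h :: "'a \<Rightarrow> ereal"
  assumes "proper h" "is_arg_min (\<lambda>x. h x + ereal (q x)) (\<lambda>_. True) u"
  shows "\<bar>h u\<bar> \<noteq> \<infinity>"
proof -
  obtain x where x: "h x \<noteq> \<infinity>" and ninf: "\<And>y. h y \<noteq> -\<infinity>"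
    using assms(1) by (auto simp: proper_def)
  have "h u + ereal (q u) \<le> h x + ereal (q x)"
    using assms(2) by (auto simp: is_arg_min_linorder)
  then have "h u \<noteq> \<infinity>" using x ninf[of x] by (cases "h x") auto
  then show ?thesis using ninf[of u] by auto
qed

text \<open>Comparing the minimizer \<open>u\<close> with the points of the segment from \<open>u\<close> to \<open>x\<close> gives the claim
  with the gain weakened by a factor \<open>1 - \<theta>\<close>, where \<open>\<theta>\<close> is the position on the segment;
  then \<open>\<theta>\<close> tends to \<open>0\<close>.\<close>

lemma minimizer_quadratic_growth:
  fixes h :: "'a::real_normed_vector \<Rightarrow> ereal"
  assumes "proper h" and convex: "ereal_strongly_convex \<sigma> h"
    and quad: "quadratic_with N q"
    and minimizer: "is_arg_min (\<lambda>x. h x + ereal (q x)) (\<lambda>_. True) u"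
    and finite: "h u = ereal hu" "h x = ereal hx"
  shows "hu + q u + \<sigma> / 2 * (norm (x - u))\<^sup>2 + N (x - u) \<le> hx + q x"
proof -
  define G where "G = \<sigma> / 2 * (norm (x - u))\<^sup>2 + N (x - u)"
  have segment: "hu + q u + (1 - \<theta>) * G \<le> hx + q x" if th: "0 < \<theta>" "\<theta> < 1" for \<theta>
  proof -
    define y where "y = (1 - \<theta>) *\<^sub>R u + \<theta> *\<^sub>R x"
    define D where "D = \<sigma> / 2 * \<theta> * (1 - \<theta>) * (norm (u - x))\<^sup>2"
    have hy: "h y + ereal D \<le> ereal ((1 - \<theta>) * hu + \<theta> * hx)"
      using convex th finite unfolding ereal_strongly_convex_def y_def D_def
      by (metis atLeastAtMost_iff less_imp_le plus_ereal.simps(1) times_ereal.simps(1))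
    moreover have "h y \<noteq> -\<infinity>" using assms(1) by (auto simp: proper_def)
    ultimately obtain k where k: "h y = ereal k" by (cases "h y") auto
    have "h u + ereal (q u) \<le> h y + ereal (q y)"
      using minimizer by (auto simp: is_arg_min_linorder)
    then have "hu + q u \<le> k + q y" using finite k by simp
    moreover have "k + D \<le> (1 - \<theta>) * hu + \<theta> * hx" using hy k by simp
    moreover have "q y = (1 - \<theta>) * q u + \<theta> * q x - \<theta> * (1 - \<theta>) * N (x - u)"
      using quad unfolding quadratic_with_def y_def by blast
    moreover have "D + \<theta> * (1 - \<theta>) * N (x - u) = \<theta> * (1 - \<theta>) * G"
      unfolding D_def G_def by (simp add: norm_minus_commute algebra_simps)
    ultimately have "\<theta> * (hu + q u + (1 - \<theta>) * G) \<le> \<theta> * (hx + q x)"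
      by (simp add: algebra_simps)
    then show ?thesis using th by simp
  qed
  have "((\<lambda>\<theta>. hu + q u + (1 - \<theta>) * G) \<longlongrightarrow> hu + q u + (1 - 0) * G) (at_right 0)"
    by (intro tendsto_intros)
  moreover have "\<forall>\<^sub>F \<theta> in at_right 0. hu + q u + (1 - \<theta>) * G \<le> hx + q x"
    using eventually_at_right_less[of 0] eventually_at_rightI[of 0 1 "\<lambda>\<theta>. hu + q u + (1 - \<theta>) * G \<le> hx + q x"]
      segment by simp
  ultimately have "hu + q u + (1 - 0) * G \<le> hx + q x"
    by (intro tendsto_upperbound) auto
  then show ?thesis by (simp add: G_def)
qed

section \<open>The primal map\<close>

text \<open>Young's inequality with the weight that makes the coefficient of \<open>E\<close> exactly \<open>1/2\<close>, so that the
  whole proximal gain is spent and the loss on \<open>|s|\<^sup>2\<close> is as small as possible; this loss is the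
  \<open>1 - \<delta>\<close> of the theorem. The weight degenerates for \<open>\<beta> = 0\<close>, but then \<open>c\<close> vanishes.\<close>

lemma cross_term_bound:
  fixes s c :: "'a::real_inner" and e :: "'b::real_normed_vector"
  assumes c: "(norm c)\<^sup>2 \<le> \<beta> * (norm e)\<^sup>2" and E: "\<mu> * (norm e)\<^sup>2 \<le> E"
    and "0 \<le> \<beta>" "0 < \<mu>" "0 < \<rho>"
  shows "\<rho> * (s \<bullet> c) \<le> \<rho> * (\<rho> * \<beta> / \<mu>) / 2 * (norm s)\<^sup>2 + 1 / 2 * E"
proof (cases "\<beta> = 0")
  case True
  then have "c = 0" using c by simp
  moreover have "0 \<le> E" using E assms(4) by (meson mult_nonneg_nonneg less_imp_le order_trans zero_le_power2)
  ultimately show ?thesis using True by simp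
next
  case False
  then have \<beta>: "\<beta> > 0" using assms by simp
  define k where "k = \<rho> * \<beta> / \<mu>"
  have k: "k > 0" using \<beta> assms by (simp add: k_def)
  have "0 \<le> (norm (k *\<^sub>R s - c))\<^sup>2" by simp
  also have "\<dots> = k\<^sup>2 * (norm s)\<^sup>2 - 2 * k * (s \<bullet> c) + (norm c)\<^sup>2"
    unfolding power2_norm_eq_inner
    by (simp add: inner_diff_left inner_diff_right inner_commute power2_eq_square algebra_simps)
  finally have "2 * k * (s \<bullet> c) \<le> k\<^sup>2 * (norm s)\<^sup>2 + \<beta> * (norm e)\<^sup>2"
    using c by linarith
  moreover have "\<beta> * (norm e)\<^sup>2 \<le> \<beta> / \<mu> * E"
    using E \<beta> assms(4) by (simp add: field_simps)
  ultimately have "2 * k * (s \<bullet> c) \<le> k\<^sup>2 * (norm s)\<^sup>2 + k / \<rho> * E"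
    using assms(5) by (simp add: k_def)
  then have "k * (2 * (s \<bullet> c)) \<le> k * (k * (norm s)\<^sup>2 + E / \<rho>)"
    by (simp add: power2_eq_square algebra_simps)
  then have "2 * (s \<bullet> c) \<le> k * (norm s)\<^sup>2 + E / \<rho>"
    using k by simp
  then have "\<rho> * (2 * (s \<bullet> c)) \<le> \<rho> * (k * (norm s)\<^sup>2 + E / \<rho>)"
    using assms(5) by simp
  then show ?thesis
    using assms(5) unfolding k_def[symmetric] by (simp add: algebra_simps)
qed

text \<open>The second-order term that the penalty contributes to the growth at \<open>u'\<close> cancels the square in
  the expansion of the penalty around \<open>u'\<close>. Only its gradient, governed by \<open>A u' + c\<close>, survives.
  With \<open>c = B v - b\<close> this is the vector at which the penalty of the second block is linearised, so
  the two blocks can be added.\<close>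

lemma first_block_step:
  fixes f :: "real^'p \<Rightarrow> ereal" and A :: "real^'p^'m" and c l :: "real^'m"
  assumes "proper f" "ereal_convex f" "psd M"
    and minimizer: "is_arg_min (\<lambda>x. f x + ereal (l \<bullet> (A *v x + c) + r / 2 * (norm (A *v x + c))\<^sup>2
                 + 1 / (2 * t) * (mnorm M (x - u))\<^sup>2)) (\<lambda>_. True) u'"
    and finite: "f u' = ereal fu" "f x = ereal fx"
  shows "fu - fx \<le> l \<bullet> (A *v (x - u')) + r * ((A *v u' + c) \<bullet> (A *v (x - u')))
      + 1 / t * Delta M x u u' - 1 / (2 * t) * (mnorm M (u' - u))\<^sup>2"
proof -
  have "quadratic_with (\<lambda>d. 0 + r / 2 * (norm (A *v d))\<^sup>2 + 1 / (2 * t) * (mnorm M d)\<^sup>2)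
      (\<lambda>x. l \<bullet> (A *v x + c) + r / 2 * (norm (A *v x + c))\<^sup>2 + 1 / (2 * t) * (mnorm M (x - u))\<^sup>2)"
    by (intro quadratic_with_add quadratic_with_cmult quadratic_with_affine
        quadratic_with_norm_sq quadratic_with_mnorm_sq assms(3))
  from minimizer_quadratic_growth[OF assms(1) assms(2)[folded ereal_strongly_convex_0] this
      minimizer finite]
  have growth: "fu + (l \<bullet> (A *v u' + c) + r / 2 * (norm (A *v u' + c))\<^sup>2
        + 1 / (2 * t) * (mnorm M (u' - u))\<^sup>2)
        + (r / 2 * (norm (A *v (x - u')))\<^sup>2 + 1 / (2 * t) * (mnorm M (x - u'))\<^sup>2)
      \<le> fx + (l \<bullet> (A *v x + c) + r / 2 * (norm (A *v x + c))\<^sup>2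
        + 1 / (2 * t) * (mnorm M (x - u))\<^sup>2)"
    by simp
  define w where "w = A *v u' + c"
  define d where "d = A *v (x - u')"
  have wd: "A *v x + c = w + d"
    by (simp add: w_def d_def matrix_vector_mult_diff_distrib)
  have "(norm (w + d))\<^sup>2 = (norm w)\<^sup>2 + 2 * (w \<bullet> d) + (norm d)\<^sup>2"
    by (simp add: power2_norm_eq_inner inner_add_left inner_add_right inner_commute)
  then have expand: "r / 2 * (norm (w + d))\<^sup>2 = r / 2 * (norm w)\<^sup>2 + r * (w \<bullet> d) + r / 2 * (norm d)\<^sup>2"
    by (simp add: algebra_simps)
  have "1 / t * Delta M x u u' = 1 / (2 * t) * (mnorm M (x - u))\<^sup>2 - 1 / (2 * t) * (mnorm M (x - u'))\<^sup>2"
    by (simp add: Delta_def diff_divide_distrib mult.commute)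
  with growth expand show ?thesis
    unfolding wd w_def[symmetric] d_def[symmetric] inner_add_right by linarith
qed

lemma second_block_step:
  fixes g :: "real^'q \<Rightarrow> ereal" and B :: "real^'q^'m" and c l w :: "real^'m"
  assumes "proper g" "ereal_strongly_convex \<sigma> g" "psd M"
    and minimizer: "is_arg_min (\<lambda>x. g x + ereal (l \<bullet> (B *v x + c) + r * (w \<bullet> (B *v x))
                 + \<tau> / 2 * (mnorm M (x - v))\<^sup>2)) (\<lambda>_. True) v'"
    and finite: "g v' = ereal gv" "g x = ereal gx"
  shows "gv - gx \<le> l \<bullet> (B *v (x - v')) + r * (w \<bullet> (B *v (x - v')))
      + \<tau> * Delta M x v v' - \<tau> / 2 * (mnorm M (v' - v))\<^sup>2 - \<sigma> / 2 * (norm (x - v'))\<^sup>2"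
proof -
  have "quadratic_with (\<lambda>d. 0 + r * 0 + \<tau> / 2 * (mnorm M d)\<^sup>2)
      (\<lambda>x. l \<bullet> (B *v x + c) + r * (w \<bullet> (B *v x + 0)) + \<tau> / 2 * (mnorm M (x - v))\<^sup>2)"
    by (intro quadratic_with_add quadratic_with_cmult quadratic_with_affine
        quadratic_with_mnorm_sq assms(3))
  then have "quadratic_with (\<lambda>d. \<tau> / 2 * (mnorm M d)\<^sup>2)
      (\<lambda>x. l \<bullet> (B *v x + c) + r * (w \<bullet> (B *v x)) + \<tau> / 2 * (mnorm M (x - v))\<^sup>2)"
    by simp
  from minimizer_quadratic_growth[OF assms(1,2) this minimizer finite]
  have "gv + (l \<bullet> (B *v v' + c) + r * (w \<bullet> (B *v v')) + \<tau> / 2 * (mnorm M (v' - v))\<^sup>2)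
        + \<sigma> / 2 * (norm (x - v'))\<^sup>2 + \<tau> / 2 * (mnorm M (x - v'))\<^sup>2
      \<le> gx + (l \<bullet> (B *v x + c) + r * (w \<bullet> (B *v x)) + \<tau> / 2 * (mnorm M (x - v))\<^sup>2)" .
  then show ?thesis
    by (simp add: Delta_def matrix_vector_mult_diff_distrib inner_add_right inner_diff_right
        right_diff_distrib)
qed

theorem lemma5p7:
  fixes f :: "real^'p \<Rightarrow> ereal" and g :: "real^'q \<Rightarrow> ereal"
    and A :: "real^'p^'m" and B :: "real^'q^'m" and b :: "real^'m"
    and \<sigma> \<rho> t :: real
    and M1 :: "real^'p^'p" and M2 :: "real^'q^'q"
  assumes f: "proper f" "lsc f" "ereal_convex f"
    and g: "proper g" "lsc g" "ereal_convex g"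
    and sigma: "\<sigma> \<ge> 0" "ereal_strongly_convex \<sigma> g"
    and saddle: "has_saddle_point f g A B b"
    and pos: "\<rho> > 0" "t > 0"
    and M: "psd M1" "psd M2"
    and M2_gt: "lambda_min M2 > \<rho> * lambda_max (transpose B ** B)"
  shows "nice_primal_map f g A B b \<sigma> \<rho> t
           (1 - \<rho> * lambda_max (transpose B ** B) / lambda_min M2) M1 M1 M2 0
           (prim_map f g A B b \<sigma> \<rho> t M1 M2)"
proof -
  define \<beta> where "\<beta> = lambda_max (transpose B ** B)"
  define \<mu> where "\<mu> = lambda_min M2"
  define \<delta> where "\<delta> = 1 - \<rho> * \<beta> / \<mu>"
  define r where "r = rho \<sigma> \<rho> t"
  define \<tau> where "\<tau> = tau \<sigma> t"
  have \<beta>: "0 \<le> \<beta>" unfolding \<beta>_def by (rule lambda_max_gram_nonneg)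
  have gap: "\<rho> * \<beta> < \<mu>" using M2_gt by (simp add: \<beta>_def \<mu>_def)
  have \<mu>: "0 < \<mu>" using gap \<beta> pos by (meson less_imp_le mult_nonneg_nonneg order_le_less_trans)
  have \<delta>: "0 < \<delta>" "\<delta> \<le> 1" using gap \<mu> \<beta> pos by (simp_all add: \<delta>_def field_simps)
  have \<tau>: "0 < \<tau>" using pos by (simp add: \<tau>_def tau_def)
  have r: "r = \<tau> * \<rho>" by (simp add: r_def \<tau>_def rho_def tau_def)
  have psd0: "psd (0 :: real^'q^'q)"
    by (simp add: psd_def transpose_def vec_eq_iff)
  have mnorm0: "mnorm (0 :: real^'q^'q) x = 0" for x by (simp add: mnorm_def)
  have main: "aug_lagrangian f g A B b r (u', v') l - aug_lagrangian f g A B b r (\<xi>1, \<xi>2) l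
      \<le> ereal (1 / t * Delta M1 \<xi>1 u u' - 1 / (2 * t) * (mnorm M1 (u' - u))\<^sup>2
               + \<tau> * Delta M2 \<xi>2 v v' - \<tau> / 2 * (mnorm (0 :: real^'q^'q) (v' - v))\<^sup>2
               - \<sigma> / 2 * (norm (\<xi>2 - v'))\<^sup>2
               - \<delta> * r / 2 * (norm (Aop A B (u', v') - b))\<^sup>2)"
    if step: "(u', v') \<in> prim_map f g A B b \<sigma> \<rho> t M1 M2 ((u, v), l)"
      and feas: "(\<xi>1, \<xi>2) \<in> feasible A B b" for u v l u' v' \<xi>1 \<xi>2
  proof -
    define c where "c = B *v v - b"
    define w where "w = A *v u' + c"
    define s where "s = A *v u' + B *v v' - b"
    have min1: "is_arg_min (\<lambda>x. f x + ereal (l \<bullet> (A *v x + c) + r / 2 * (norm (A *v x + c))\<^sup>2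
                 + 1 / (2 * t) * (mnorm M1 (x - u))\<^sup>2)) (\<lambda>_. True) u'"
      using step by (simp add: prim_map_def c_def r_def add_diff_eq)
    have swap: "B *v x + (A *v u' - b) = A *v u' + B *v x - b" for x by simp
    have min2: "is_arg_min (\<lambda>x. g x + ereal (l \<bullet> (B *v x + (A *v u' - b))
                 + r * (w \<bullet> (B *v x)) + \<tau> / 2 * (mnorm M2 (x - v))\<^sup>2)) (\<lambda>_. True) v'"
      using step unfolding swap
      by (simp add: prim_map_def w_def c_def r_def \<tau>_def add_diff_eq[of "A *v u'" "B *v v"])
    obtain fu where fu: "f u' = ereal fu"
      using finite_at_minimizer[OF f(1) min1] by (cases "f u'") auto
    obtain gv where gv: "g v' = ereal gv"
      using finite_at_minimizer[OF g(1) min2] by (cases "g v'") auto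
    have L': "aug_lagrangian f g A B b r (u', v') l
        = ereal (fu + gv + l \<bullet> s + r / 2 * (norm s)\<^sup>2)"
      by (simp add: aug_lagrangian_def Psi_def Aop_def fu gv s_def)
    have \<xi>: "A *v \<xi>1 + B *v \<xi>2 = b" using feas by (simp add: feasible_def Aop_def)
    have L: "aug_lagrangian f g A B b r (\<xi>1, \<xi>2) l = f \<xi>1 + g \<xi>2"
      by (simp add: aug_lagrangian_def Psi_def Aop_def \<xi> zero_ereal_def[symmetric])
    have ninf: "f \<xi>1 \<noteq> -\<infinity>" "g \<xi>2 \<noteq> -\<infinity>" using f(1) g(1) by (auto simp: proper_def)
    show ?thesis
    proof (cases "f \<xi>1 = \<infinity> \<or> g \<xi>2 = \<infinity>")
      case True
      then have "aug_lagrangian f g A B b r (\<xi>1, \<xi>2) l = \<infinity>" using ninf by (auto simp: L)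
      then show ?thesis by (simp add: L')
    next
      case False
      then obtain fx gx where fx: "f \<xi>1 = ereal fx" and gx: "g \<xi>2 = ereal gx"
        using ninf by (cases "f \<xi>1"; cases "g \<xi>2") auto
      define d1 where "d1 = A *v (\<xi>1 - u')"
      define d2 where "d2 = B *v (\<xi>2 - v')"
      define e where "e = v' - v"
      note step1 = first_block_step[OF f(1,3) M(1) min1 fu fx, folded w_def d1_def]
      note step2 = second_block_step[OF g(1) sigma(2) M(2) min2 gv gx, folded d2_def e_def]
      have d: "d1 + d2 = - s"
        using \<xi> by (simp add: d1_def d2_def s_def matrix_vector_mult_diff_distrib algebra_simps)
      have ws: "w = s - B *v e"
        by (simp add: w_def c_def s_def e_def matrix_vector_mult_diff_distrib)
      have "l \<bullet> d1 + l \<bullet> d2 = - (l \<bullet> s)" by (metis d inner_add_right inner_minus_right)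
      moreover have "r * (w \<bullet> d1) + r * (w \<bullet> d2) = - r * (norm s)\<^sup>2 + r * (s \<bullet> (B *v e))"
      proof -
        have "w \<bullet> d1 + w \<bullet> d2 = - (w \<bullet> s)" by (metis d inner_add_right inner_minus_right)
        also have "\<dots> = - (norm s)\<^sup>2 + s \<bullet> (B *v e)"
          by (simp add: ws inner_diff_left power2_norm_eq_inner inner_commute[of "B *v e" s])
        finally show ?thesis by (metis distrib_left mult_minus_left mult_minus_right)
      qed
      moreover have "r * (s \<bullet> (B *v e)) \<le> (1 - \<delta>) * r / 2 * (norm s)\<^sup>2 + \<tau> / 2 * (mnorm M2 e)\<^sup>2"
      proof -
        have "\<mu> * (norm e)\<^sup>2 \<le> (mnorm M2 e)\<^sup>2"
          unfolding \<mu>_def mnorm_sq[OF M(2)]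
          using M(2) by (intro lambda_min_le_form) (simp add: psd_def)
        then have "\<rho> * (s \<bullet> (B *v e)) \<le> \<rho> * (\<rho> * \<beta> / \<mu>) / 2 * (norm s)\<^sup>2 + 1 / 2 * (mnorm M2 e)\<^sup>2"
          using norm_sq_le_lambda_max[of B e, folded \<beta>_def] \<beta> \<mu> pos(1)
          by (intro cross_term_bound)
        then have "\<tau> * (\<rho> * (s \<bullet> (B *v e)))
            \<le> \<tau> * (\<rho> * (\<rho> * \<beta> / \<mu>) / 2 * (norm s)\<^sup>2 + 1 / 2 * (mnorm M2 e)\<^sup>2)"
          using \<tau> by simp
        then show ?thesis by (simp add: r \<delta>_def algebra_simps)
      qed
      moreover have "(1 - \<delta>) * r / 2 * (norm s)\<^sup>2
          = r / 2 * (norm s)\<^sup>2 - \<delta> * r / 2 * (norm s)\<^sup>2"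
        by (simp add: field_simps)
      ultimately have "(fu + gv + l \<bullet> s + r / 2 * (norm s)\<^sup>2) - (fx + gx)
          \<le> 1 / t * Delta M1 \<xi>1 u u' - 1 / (2 * t) * (mnorm M1 (u' - u))\<^sup>2
            + \<tau> * Delta M2 \<xi>2 v v' - \<sigma> / 2 * (norm (\<xi>2 - v'))\<^sup>2 - \<delta> * r / 2 * (norm s)\<^sup>2"
        using step1 step2 by linarith
      then show ?thesis
        by (simp add: L' L fx gx mnorm0 Aop_def s_def)
    qed
  qed
  show ?thesis
    unfolding nice_primal_map_def using \<delta> M psd0 main
    by (auto simp: r_def \<tau>_def \<delta>_def \<beta>_def \<mu>_def)
qed

end
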